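(* Let $\{f_i\}_{i=1}^k$ be a frame for $\mathcal{H}^n$ and let $\{h_i\}_{i=1}^k$ be a dual frame of $\{f_i\}_{i=1}^k$. If $\{g_i\}_{i=1}^k$ is the canonical dual frame of $\{f_i\}_{i=1}^k$, then for any $p\in(2,\infty)$, $$\sum_{i=1}^k|\langle f,g_i\rangle|^p\le k^{\left(\frac{1}{2}p-1\right)}\sum_{i=1}^k|\langle f,h_i\rangle|^p\qquad\text{for all } f\in\mathcal{H}^n.$$
   Context: $\mathcal{H}^n$ denotes $\mathbb{R}^n$ or $\mathbb{C}^n$. A finite sequence $F=\{f_i\}_{i=1}^k$ in $\mathcal{H}^n$ is a frame for $\mathcal{H}^n$ if there are constants $A,B>0$ with $A\|f\|^2\le\sum_{i=1}^k|\langle f,f_i\rangle|^2\le B\|f\|^2$ for all $f\in\mathcal{H}^n$. A frame $\{h_i\}_{i=1}^k$ is a dual frame of $F$ if $f=\sum_{i=1}^k\langle f,f_i\rangle h_i$ for all $f\in\mathcal{H}^n$. The frame operator is $S_Fx=\sum_{i=1}^k\langle x,f_i\rangle f_i$ (invertible), and the canonical dual frame is $\{S_F^{-1}f_i\}_{i=1}^k$. *)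

theory Defs
  imports "HOL-Analysis.Analysis"
begin

text \<open>
  The scalar field is \<open>real\<close> or \<open>complex\<close>. The notions below take the scalar-valued inner product
  \<open>ip\<close> as a parameter: it is \<^const>\<open>inner\<close> on \<open>real ^ 'n\<close> and \<open>cinner\<close> on \<open>complex ^ 'n\<close>
  (there, \<^const>\<open>inner\<close> is only the real part of the Hermitian product). In both
  cases the norm induced by \<open>ip\<close> is the library norm of the vector type.
\<close>

definition cinner :: "complex ^ 'n \<Rightarrow> complex ^ 'n \<Rightarrow> complex" where
  "cinner x y = (\<Sum>j\<in>UNIV. x $ j * cnj (y $ j))"

lemma cinner_self: "cinner x x = complex_of_real ((norm x)\<^sup>2)"
  by (simp add: cinner_def norm_vec_def L2_set_def sum_nonneg flip: complex_norm_square)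

text \<open>Sequences of length \<open>k\<close> are functions on \<open>nat\<close>, of which only the values on \<open>{1..k}\<close> matter.\<close>

definition is_frame ::
  "('a::real_normed_field ^ 'n \<Rightarrow> 'a ^ 'n \<Rightarrow> 'a) \<Rightarrow> nat \<Rightarrow> (nat \<Rightarrow> 'a ^ 'n) \<Rightarrow> bool" where
  "is_frame ip k f \<longleftrightarrow>
     (\<exists>A>0. \<exists>B>0. \<forall>x. A * (norm x)\<^sup>2 \<le> (\<Sum>i=1..k. (norm (ip x (f i)))\<^sup>2) \<and>
                     (\<Sum>i=1..k. (norm (ip x (f i)))\<^sup>2) \<le> B * (norm x)\<^sup>2)"

definition is_dual_frame ::
  "('a::real_normed_field ^ 'n \<Rightarrow> 'a ^ 'n \<Rightarrow> 'a) \<Rightarrow> nat \<Rightarrow> (nat \<Rightarrow> 'a ^ 'n) \<Rightarrow> (nat \<Rightarrow> 'a ^ 'n) \<Rightarrow> bool" where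
  "is_dual_frame ip k f h \<longleftrightarrow>
     is_frame ip k h \<and> (\<forall>x. x = (\<Sum>i=1..k. ip x (f i) *s h i))"

definition frame_operator ::
  "('a::real_normed_field ^ 'n \<Rightarrow> 'a ^ 'n \<Rightarrow> 'a) \<Rightarrow> nat \<Rightarrow> (nat \<Rightarrow> 'a ^ 'n) \<Rightarrow> 'a ^ 'n \<Rightarrow> 'a ^ 'n" where
  "frame_operator ip k f x = (\<Sum>i=1..k. ip x (f i) *s f i)"

text \<open>For a frame the frame operator is bijective, so \<^const>\<open>inv\<close> is its genuine inverse.\<close>

definition canonical_dual ::
  "('a::real_normed_field ^ 'n \<Rightarrow> 'a ^ 'n \<Rightarrow> 'a) \<Rightarrow> nat \<Rightarrow> (nat \<Rightarrow> 'a ^ 'n) \<Rightarrow> nat \<Rightarrow> 'a ^ 'n" where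
  "canonical_dual ip k f i = inv (frame_operator ip k f) (f i)"

end

theory Submission
  imports Defs
begin

text \<open>
  Put \<open>u = S\<^sup>-\<^sup>1 x\<close>. Since \<open>S\<close> is self-adjoint, \<open>\<langle>x, g\<^sub>i\<rangle> = \<langle>u, f\<^sub>i\<rangle>\<close>, so \<open>\<Sum>|\<langle>x, g\<^sub>i\<rangle>|\<^sup>2 = \<langle>u, x\<rangle>\<close>;
  expanding \<open>u = \<Sum>\<langle>u, f\<^sub>i\<rangle> h\<^sub>i\<close> bounds this by \<open>\<Sum>|\<langle>x, g\<^sub>i\<rangle>| |\<langle>x, h\<^sub>i\<rangle>|\<close>. Hence the canonical
  coefficients have the smaller \<open>\<ell>\<^sup>2\<close> norm, and the claim follows from
  \<open>\<parallel>a\<parallel>\<^sub>p \<le> \<parallel>a\<parallel>\<^sub>2\<close> and \<open>\<parallel>b\<parallel>\<^sub>2 \<le> k\<^bsup>1/2 - 1/p\<^esup> \<parallel>b\<parallel>\<^sub>p\<close>.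
\<close>

lemma square_powr_half:
  fixes a :: real
  assumes "0 \<le> a"
  shows "(a\<^sup>2) powr (p / 2) = a powr p"
  using assms by (cases "a = 0") (auto simp: powr_powr simp flip: powr_numeral)

text \<open>Each term is at most the total \<open>T\<close>, so
  \<open>a i powr q = a i * a i powr (q - 1)\<close> is at most \<open>a i * T powr (q - 1)\<close>;
  summing over \<open>i\<close> gives \<open>T powr q\<close>.\<close>

lemma sum_powr_le_powr_sum:
  fixes a :: "'i \<Rightarrow> real"
  assumes "finite I" "\<And>i. i \<in> I \<Longrightarrow> 0 \<le> a i" "1 \<le> q"
  shows "(\<Sum>i\<in>I. a i powr q) \<le> (\<Sum>i\<in>I. a i) powr q"
proof -
  define T where "T = (\<Sum>i\<in>I. a i)"
  have T: "0 \<le> T" unfolding T_def using assms by (simp add: sum_nonneg)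
  have split: "t powr q = t * t powr (q - 1)" if "0 \<le> t" for t :: real
    using that by (simp add: powr_mult_base)
  have "(\<Sum>i\<in>I. a i powr q) = (\<Sum>i\<in>I. a i * a i powr (q - 1))"
    using assms split by simp
  also have "\<dots> \<le> (\<Sum>i\<in>I. a i * T powr (q - 1))"
    using assms unfolding T_def
    by (intro sum_mono mult_left_mono powr_mono2 member_le_sum) auto
  also have "\<dots> = T powr q"
    using split[OF T] by (simp add: T_def sum_distrib_right)
  finally show ?thesis by (simp add: T_def)
qed

text \<open>This is Jensen's inequality for the convex function \<open>t powr q\<close> with equal
  weights, multiplied through by the \<open>q\<close>-th power of the number of terms.\<close>

lemma powr_sum_le_card_sum_powr:
  fixes b :: "'i \<Rightarrow> real"
  assumes I: "finite I" and b: "\<And>i. i \<in> I \<Longrightarrow> 0 \<le> b i" and q: "1 \<le> q"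
  shows "(\<Sum>i\<in>I. b i) powr q \<le> real (card I) powr (q - 1) * (\<Sum>i\<in>I. b i powr q)"
proof -
  \<comment> \<open>Jensen is applied to the positive terms only. Zero terms add nothing to either
    sum, and passing from \<open>card J\<close> back to \<open>card I\<close> can only enlarge the
    factor, since \<open>q - 1\<close> is nonnegative.\<close>
  define J where "J = {i \<in> I. 0 < b i}"
  define n where "n = real (card J)"
  have J: "finite J" "J \<subseteq> I" using I by (auto simp: J_def)
  have zero: "b i = 0" if "i \<in> I - J" for i
    using that b by (force simp: J_def)
  have J_bound: "(\<Sum>i\<in>J. b i) powr q \<le> n powr (q - 1) * (\<Sum>i\<in>J. b i powr q)"
  proof (cases "J = {}")
    case False
    have n: "0 < n" using J False by (simp add: n_def card_gt_0_iff)
    have "(\<Sum>i\<in>J. (1 / n) *\<^sub>R b i) powr q \<le> (\<Sum>i\<in>J. (1 / n) * b i powr q)"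
      by (rule convex_on_sum[OF J(1) False powr_convex[OF q]])
        (use n in \<open>auto simp: n_def J_def\<close>)
    then have "((\<Sum>i\<in>J. b i) / n) powr q \<le> (\<Sum>i\<in>J. b i powr q) / n"
      by (simp add: sum_divide_distrib)
    moreover have "0 \<le> (\<Sum>i\<in>J. b i)" by (rule sum_nonneg) (simp add: J_def)
    ultimately show ?thesis
      using n by (simp add: powr_divide powr_diff field_simps)
  qed simp
  have "(\<Sum>i\<in>I. b i) powr q = (\<Sum>i\<in>J. b i) powr q"
    using sum.mono_neutral_right[OF I J(2), of b] zero by simp
  also have "\<dots> \<le> n powr (q - 1) * (\<Sum>i\<in>J. b i powr q)" by (rule J_bound)
  also have "\<dots> \<le> real (card I) powr (q - 1) * (\<Sum>i\<in>I. b i powr q)"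
    using q I J unfolding n_def
    by (intro mult_mono powr_mono2 sum_mono2 sum_nonneg) (auto simp: card_mono)
  finally show ?thesis .
qed

text \<open>Treats both scalar fields at once: \<open>conj\<close> is \<open>id\<close> in the real
  case and \<open>cnj\<close> in the complex case.\<close>

locale hermitian_form =
  fixes ip :: "'a::real_normed_field ^ 'n \<Rightarrow> 'a ^ 'n \<Rightarrow> 'a" and conj :: "'a \<Rightarrow> 'a"
  assumes add_left: "ip (x + y) z = ip x z + ip y z"
    and scale_left: "ip (c *s x) y = c * ip x y"
    and commute: "ip y x = conj (ip x y)"
    and conj_add: "conj (a + b) = conj a + conj b"
    and conj_mult: "conj (a * b) = conj a * conj b"
    and mult_conj: "a * conj a = of_real ((norm a)\<^sup>2)"
begin

lemma conj_zero: "conj 0 = 0"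
  using conj_add[of 0 0] by simp

lemma norm_conj: "norm (conj a) = norm a"
proof (cases "a = 0")
  case False
  have "norm a * norm (conj a) = norm a * norm a"
    by (metis mult_conj norm_mult norm_of_real abs_power2 abs_norm_cancel power2_eq_square)
  then show ?thesis using False by simp
qed (simp add: conj_zero)

lemma zero_left: "ip 0 y = 0"
  using add_left[of 0 0 y] by simp

lemma sum_left: "ip (\<Sum>i\<in>I. v i) y = (\<Sum>i\<in>I. ip (v i) y)"
  by (induction I rule: infinite_finite_induct) (simp_all add: zero_left add_left)

lemma conj_sum: "conj (\<Sum>i\<in>I. c i) = (\<Sum>i\<in>I. conj (c i))"
  by (induction I rule: infinite_finite_induct) (simp_all add: conj_zero conj_add)

lemma norm_commute: "norm (ip x y) = norm (ip y x)"
  by (metis commute norm_conj)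

text \<open>Writing \<open>ip x (S y)\<close> as \<open>conj (ip (S y) x)\<close> lets
  \<open>conj\<close> pass through the finite sum, where \<open>commute\<close> swaps the arguments
  of each factor.\<close>

lemma frame_operator_self_adjoint:
  "ip (frame_operator ip k f x) y = ip x (frame_operator ip k f y)"
proof -
  have "ip x (frame_operator ip k f y) = conj (\<Sum>i=1..k. ip y (f i) * ip (f i) x)"
    by (subst commute) (simp add: frame_operator_def sum_left scale_left)
  also have "\<dots> = (\<Sum>i=1..k. ip (f i) y * ip x (f i))"
    by (simp add: conj_sum conj_mult flip: commute)
  finally show ?thesis
    by (simp add: frame_operator_def sum_left scale_left mult.commute)
qed

text \<open>Serves twice: for the injectivity of the frame operator, and to express the squared norm
  of the canonical coefficients as an inner product.\<close>

lemma frame_operator_quadratic: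
  "ip (frame_operator ip k f x) x = of_real (\<Sum>i=1..k. (norm (ip x (f i)))\<^sup>2)"
proof -
  have "ip (frame_operator ip k f x) x = (\<Sum>i=1..k. ip x (f i) * conj (ip x (f i)))"
    by (simp add: frame_operator_def sum_left scale_left flip: commute)
  then show ?thesis by (simp add: mult_conj)
qed

text \<open>If \<open>S x = 0\<close>, the quadratic form vanishes at \<open>x\<close>, and the
  lower frame bound forces \<open>x = 0\<close>. An injective linear endomorphism of a
  finite-dimensional space is surjective.\<close>

lemma bij_frame_operator:
  assumes "is_frame ip k f"
  shows "bij (frame_operator ip k f)"
proof -
  let ?S = "frame_operator ip k f"
  have lin: "Vector_Spaces.linear (*s) (*s) ?S"
    by unfold_locales
      (simp_all add: frame_operator_def add_left scale_left sum.distrib vec.scale_left_distrib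
        vec.scale_sum_right)
  have "x = 0" if "?S x = 0" for x
  proof -
    obtain A where A: "A > 0" "A * (norm x)\<^sup>2 \<le> (\<Sum>i=1..k. (norm (ip x (f i)))\<^sup>2)"
      using assms unfolding is_frame_def by blast
    have "(\<Sum>i=1..k. (norm (ip x (f i)))\<^sup>2) = 0"
      using frame_operator_quadratic[of k f x] that by (simp add: zero_left del: of_real_sum)
    with A show ?thesis by (simp add: mult_le_0_iff)
  qed
  then have inj: "inj ?S"
    using vec.linear_inj_iff_eq_0[OF lin] by blast
  then show ?thesis
    using vec.linear_inj_imp_surj[OF lin] by (simp add: bij_def)
qed

lemma canonical_dual_l2_minimal:
  assumes frame: "is_frame ip k f" and dual: "is_dual_frame ip k f h"
  shows "(\<Sum>i=1..k. (norm (ip x (canonical_dual ip k f i)))\<^sup>2) \<le> (\<Sum>i=1..k. (norm (ip x (h i)))\<^sup>2)"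
proof -
  let ?S = "frame_operator ip k f"
  have bij: "bij ?S" by (rule bij_frame_operator[OF frame])
  define u where "u = inv ?S x"
  have Su: "?S u = x" unfolding u_def by (rule surj_f_inv_f[OF bij_is_surj[OF bij]])
  define a where "a i = norm (ip u (f i))" for i
  define b where "b i = norm (ip x (h i))" for i
  \<comment> \<open>Self-adjointness moves \<open>S\<close> across:
    \<open>ip x (inv S (f i)) = ip (S u) (inv S (f i)) = ip u (f i)\<close>.\<close>
  have a: "norm (ip x (canonical_dual ip k f i)) = a i" for i
    by (metis a_def canonical_dual_def frame_operator_self_adjoint Su surj_f_inv_f
        bij_is_surj[OF bij])
  have "(\<Sum>i=1..k. (a i)\<^sup>2) = norm (ip x u)"
    using frame_operator_quadratic[of k f u] by (simp add: Su a_def sum_nonneg del: of_real_sum)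
  also have "\<dots> = norm (ip (\<Sum>i=1..k. ip u (f i) *s h i) x)"
    using dual norm_commute unfolding is_dual_frame_def by metis
  also have "\<dots> \<le> (\<Sum>i=1..k. a i * b i)"
    unfolding sum_left a_def b_def
    by (rule sum_norm_le) (simp add: scale_left norm_mult norm_commute[of x])
  \<comment> \<open>Termwise AM-GM takes the place of Cauchy-Schwarz: half of the sum of
    \<open>(a i)\<^sup>2\<close> is then absorbed by the left-hand side.\<close>
  also have "\<dots> \<le> (\<Sum>i=1..k. ((a i)\<^sup>2 + (b i)\<^sup>2) / 2)"
  proof (rule sum_mono)
    show "a i * b i \<le> ((a i)\<^sup>2 + (b i)\<^sup>2) / 2" for i
      using sum_squares_bound[of "a i" "b i"] by simp
  qed
  also have "\<dots> = ((\<Sum>i=1..k. (a i)\<^sup>2) + (\<Sum>i=1..k. (b i)\<^sup>2)) / 2"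
    by (simp add: sum.distrib flip: sum_divide_distrib)
  finally show ?thesis by (simp add: a b_def)
qed

text \<open>Both power-sum inequalities are applied to squared coefficients with exponent
  \<open>q = p / 2\<close>, so the factor \<open>k powr (q - 1)\<close> is exactly the claimed
  constant.\<close>

lemma canonical_dual_lp_bound:
  assumes "is_frame ip k f" "is_dual_frame ip k f h"
    and g: "\<forall>i\<in>{1..k}. g i = canonical_dual ip k f i" and p: "2 < p"
  shows "(\<Sum>i=1..k. norm (ip x (g i)) powr p)
    \<le> real k powr (p / 2 - 1) * (\<Sum>i=1..k. norm (ip x (h i)) powr p)"
proof -
  let ?a = "\<lambda>i. norm (ip x (canonical_dual ip k f i))" and ?b = "\<lambda>i. norm (ip x (h i))"
  have "(\<Sum>i=1..k. norm (ip x (g i)) powr p) = (\<Sum>i=1..k. ((?a i)\<^sup>2) powr (p / 2))"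
    using g by (simp add: square_powr_half)
  also have "\<dots> \<le> (\<Sum>i=1..k. (?a i)\<^sup>2) powr (p / 2)"
    using p by (intro sum_powr_le_powr_sum) auto
  also have "\<dots> \<le> (\<Sum>i=1..k. (?b i)\<^sup>2) powr (p / 2)"
    using p assms by (intro powr_mono2 canonical_dual_l2_minimal sum_nonneg) auto
  also have "\<dots> \<le> real k powr (p / 2 - 1) * (\<Sum>i=1..k. ((?b i)\<^sup>2) powr (p / 2))"
    using powr_sum_le_card_sum_powr[of "{1..k}" "\<lambda>i. (?b i)\<^sup>2" "p / 2"] p by simp
  finally show ?thesis by (simp add: square_powr_half)
qed

end

lemma hermitian_form_inner: "hermitian_form (inner :: real ^ 'n \<Rightarrow> _) id"
proof
  fix x y z :: "real ^ 'n" and c :: real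
  show "(x + y) \<bullet> z = x \<bullet> z + y \<bullet> z" by (rule inner_add_left)
  show "(c *s x) \<bullet> y = c * (x \<bullet> y)" by (simp add: scalar_mult_eq_scaleR)
  show "y \<bullet> x = id (x \<bullet> y)" by (simp add: inner_commute)
qed (simp_all add: power2_eq_square)

lemma hermitian_form_cinner: "hermitian_form (cinner :: complex ^ 'n \<Rightarrow> _) cnj"
  by unfold_locales
    (simp_all add: cinner_def sum.distrib sum_distrib_left algebra_simps
      flip: complex_norm_square of_real_power)

theorem theorem5p1:
  "(\<forall>(k::nat) (f :: nat \<Rightarrow> real ^ 'n) (h :: nat \<Rightarrow> real ^ 'n) (g :: nat \<Rightarrow> real ^ 'n) (p::real).
      is_frame inner k f \<longrightarrow> is_dual_frame inner k f h \<longrightarrow>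
      (\<forall>i\<in>{1..k}. g i = canonical_dual inner k f i) \<longrightarrow> 2 < p \<longrightarrow>
      (\<forall>x. (\<Sum>i=1..k. \<bar>inner x (g i)\<bar> powr p)
            \<le> real k powr (p / 2 - 1) * (\<Sum>i=1..k. \<bar>inner x (h i)\<bar> powr p)))
   \<and>
   (\<forall>(k::nat) (f :: nat \<Rightarrow> complex ^ 'n) (h :: nat \<Rightarrow> complex ^ 'n) (g :: nat \<Rightarrow> complex ^ 'n) (p::real).
      is_frame cinner k f \<longrightarrow> is_dual_frame cinner k f h \<longrightarrow>
      (\<forall>i\<in>{1..k}. g i = canonical_dual cinner k f i) \<longrightarrow> 2 < p \<longrightarrow>
      (\<forall>x. (\<Sum>i=1..k. norm (cinner x (g i)) powr p)
            \<le> real k powr (p / 2 - 1) * (\<Sum>i=1..k. norm (cinner x (h i)) powr p)))"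
  by (intro conjI allI impI
      hermitian_form.canonical_dual_lp_bound[OF hermitian_form_inner, unfolded real_norm_def]
      hermitian_form.canonical_dual_lp_bound[OF hermitian_form_cinner])

end
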